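(* Let $\eta\in M_1(\mathbb{R})$, let $T:\mathbb{R}\to\mathbb{R}$ be a Borel measurable function, set $\nu=T_\star\eta$, and let $\gamma_T=(I_{\mathbb{R}},T)_\star\eta$ be the deterministic transport plan of $\eta$ by $T$. Then $\gamma_T\in\Pi_c(\eta,\nu)$ if and only if $T$ satisfies (at least) one of the following two conditions: (1) $T(x)\ge x$ for $\eta$-almost every $x$. (2) There exists $t_0\in\mathbb{R}$ such that for all $x\le t_0$ outside an $\eta$-negligible set we have $T(x)\ge x$, and for all $x>t_0$ outside an $\eta$-negligible set we have $T(x)=t_0$.
   Context: $M_1(\mathbb{R})$ (resp. $M_1(\mathbb{R}\times\mathbb{R})$) is the set of Borel probability measures on $\mathbb{R}$ (resp. $\mathbb{R}\times\mathbb{R}$); $\mathcal{B}(\mathbb{R})$ is the Borel $\sigma$-field. $T_\star\eta$ denotes the pushforward of $\eta$ by $T$, and $(I_{\mathbb{R}},T)_\star\eta$ is the pushforward of $\eta$ by $x\mapsto(x,T(x))$. For $t\in\mathbb{R}$, $\mathcal{B}_t(\mathbb{R})=\{A\in\mathcal{B}(\mathbb{R}): A\subset(-\infty,t)\text{ or }[t,+\infty)\subset A\}$, equivalently the $\sigma$-field generated by the sets $(-\infty,a]$, $a<t$. For a sub-$\sigma$-field $\mathcal{G}\subset\mathcal{B}(\mathbb{R})$, $\mathcal{G}^\eta$ is the smallest $\sigma$-field containing $\mathcal{G}$ and all $\eta$-negligible sets (subsets of Borel sets of $\eta$-measure $0$). $\Pi(\eta,\nu)$ is the set of $\gamma\in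 M_1(\mathbb{R}\times\mathbb{R})$ with first marginal $\eta$ and second marginal $\nu$. For $\gamma\in\Pi(\eta,\nu)$, a transport kernel $Q_\gamma:x\mapsto Q_\gamma^x\in M_1(\mathbb{R})$ is a map such that $\phi_B:x\mapsto Q_\gamma^x(B)$ is Borel measurable for every $B\in\mathcal{B}(\mathbb{R})$ and $\gamma(A\times B)=\int_A Q_\gamma^x(B)\,\eta(dx)$ for all $A,B\in\mathcal{B}(\mathbb{R})$; it exists and is unique up to an $\eta$-negligible set. The filtration generated by $\gamma$ is, for $t\in\mathbb{R}$, $$\mathcal{G}_t(\gamma)=\sigma(\phi_B: B\in\mathcal{B}_t(\mathbb{R}),\ \nu(\partial B)=0)^\eta,$$ where $\partial B$ is the topological boundary. The set of causal (or adapted) transport plans is $\Pi_c(\eta,\nu)=\{\gamma\in\Pi(\eta,\nu):\mathcal{G}_t(\gamma)\subset\mathcal{B}_t(\mathbb{R})^\eta\ \ \forall t\in\mathbb{R}\}$. *)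

theory Defs
  imports "HOL-Probability.Probability"
begin

abbreviation prob_measures :: "'a::topological_space measure set" where
  "prob_measures \<equiv> space (prob_algebra borel)"

definition borel_upto :: "real \<Rightarrow> real set set" where
  "borel_upto t = {A \<in> sets borel. A \<subseteq> {..<t} \<or> {t..} \<subseteq> A}"

definition negligible_sets :: "real measure \<Rightarrow> real set set" where
  "negligible_sets \<eta> = {N. \<exists>N'\<in>null_sets \<eta>. N \<subseteq> N'}"

definition augment :: "real measure \<Rightarrow> real set set \<Rightarrow> real set set" where
  "augment \<eta> \<G> = sigma_sets UNIV (\<G> \<union> negligible_sets \<eta>)"

definition transport_plans :: "real measure \<Rightarrow> real measure \<Rightarrow> (real \<times> real) measure set" where
  "transport_plans \<eta> \<nu> =
     {\<gamma> \<in> prob_measures. distr \<gamma> borel fst = \<eta> \<and> distr \<gamma> borel snd = \<nu>}"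

definition is_transport_kernel ::
    "real measure \<Rightarrow> (real \<times> real) measure \<Rightarrow> (real \<Rightarrow> real measure) \<Rightarrow> bool" where
  "is_transport_kernel \<eta> \<gamma> Q \<longleftrightarrow>
     (\<forall>x. Q x \<in> prob_measures) \<and>
     (\<forall>B\<in>sets borel. (\<lambda>x. measure (Q x) B) \<in> borel_measurable borel) \<and>
     (\<forall>A\<in>sets borel. \<forall>B\<in>sets borel.
        emeasure \<gamma> (A \<times> B) = (\<integral>\<^sup>+x\<in>A. emeasure (Q x) B \<partial>\<eta>))"

text \<open>Transport kernels of a plan with first marginal \<open>\<eta>\<close> exist and agree outside an
  \<open>\<eta>\<close>-negligible set. Since \<open>plan_filtration\<close> is augmented by the negligible sets, it does not
  depend on which kernel is chosen here.\<close>

definition transport_kernel ::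
    "real measure \<Rightarrow> (real \<times> real) measure \<Rightarrow> real \<Rightarrow> real measure" where
  "transport_kernel \<eta> \<gamma> = (SOME Q. is_transport_kernel \<eta> \<gamma> Q)"

text \<open>The arguments \<open>\<eta>\<close> and \<open>\<nu>\<close> are meant to be the two marginals of \<open>\<gamma>\<close>.\<close>

definition plan_filtration ::
    "real measure \<Rightarrow> real measure \<Rightarrow> (real \<times> real) measure \<Rightarrow> real \<Rightarrow> real set set" where
  "plan_filtration \<eta> \<nu> \<gamma> t =
     augment \<eta> (sigma_sets UNIV
       {(\<lambda>x. measure (transport_kernel \<eta> \<gamma> x) B) -` S | B S.
          B \<in> borel_upto t \<and> emeasure \<nu> (frontier B) = 0 \<and> S \<in> sets borel})"

definition causal_plans :: "real measure \<Rightarrow> real measure \<Rightarrow> (real \<times> real) measure set" where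
  "causal_plans \<eta> \<nu> =
     {\<gamma> \<in> transport_plans \<eta> \<nu>. \<forall>t. plan_filtration \<eta> \<nu> \<gamma> t \<subseteq> augment \<eta> (borel_upto t)}"

definition deterministic_plan :: "real measure \<Rightarrow> (real \<Rightarrow> real) \<Rightarrow> (real \<times> real) measure" where
  "deterministic_plan \<eta> T = distr \<eta> borel (\<lambda>x. (x, T x))"

end

theory Submission
  imports Defs
begin

text \<open>
  The deterministic plan of \<open>T\<close> has kernel \<open>x \<mapsto> \<delta>\<^bsub>T x\<^esub>\<close>, so its filtration is generated,
  up to negligible sets, by the preimages \<open>T -` B\<close>. On the other side, a Borel set is
  measurable at time \<open>t\<close> up to negligible sets exactly when it is \<open>\<eta>\<close>-trivial on \<open>[t,
  \<infinity>)\<close>, that is, contains almost all or almost no points there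
  (\<open>mem_augment_borel_upto_iff\<close>): nothing that happens after \<open>t\<close> may be distinguished.
  Causality is therefore a zero-one law (\<open>deterministic_plan_causal_iff\<close>): whenever \<open>B\<close>
  is known at time \<open>t\<close> and \<open>\<partial>B\<close> carries no mass of \<open>\<nu>\<close>, either almost all points of \<open>[t,
  \<infinity>)\<close> are sent to \<open>B\<close>, or almost none.

  Either of the two conditions on \<open>T\<close> gives this law directly. Conversely, call a time
  \<open>t\<close> bad if a non-negligible part of \<open>[t, \<infinity>)\<close> is sent to \<open>(-\<infinity>, t)\<close>. The zero-one law
  for the sets \<open>(-\<infinity>, a]\<close>, where \<open>a < t\<close> runs through the dense set of non-atoms of \<open>\<nu>\<close>,
  says that the distribution function of \<open>T\<close> on \<open>[t, \<infinity>)\<close> takes only its two extreme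
  values below \<open>t\<close>; as \<open>t\<close> is bad, \<open>T\<close> is almost surely equal to a constant \<open>c < t\<close> on
  \<open>[t, \<infinity>)\<close> (\<open>constant_after_bad_time\<close>). Two bad times share a half-line of positive
  mass, so the constant \<open>c\<close> is common to all bad times. Hence every bad time exceeds
  \<open>c\<close>. If one bad time exists, then all times \<open>s\<close> in \<open>(c, t]\<close> are bad too, because \<open>[t,
  \<infinity>)\<close> has positive mass and is sent to \<open>c < s\<close>. So \<open>T = c\<close> almost surely on \<open>(c, \<infinity>)\<close>;
  since no time \<open>\<le> c\<close> is bad, \<open>T x \<ge> x\<close> almost surely for \<open>x \<le> c\<close>. This is condition (2)
  with \<open>t\<^sub>0 = c\<close>. If there is no bad time, condition (1) holds.
\<close>

section \<open>Sets known at a given time, up to negligible sets\<close>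

definition trivial_from :: "real measure \<Rightarrow> real \<Rightarrow> real set \<Rightarrow> bool" where
  "trivial_from \<eta> t A \<longleftrightarrow>
     (AE x in \<eta>. t \<le> x \<longrightarrow> x \<in> A) \<or> (AE x in \<eta>. t \<le> x \<longrightarrow> x \<notin> A)"

lemma trivial_from_Compl: "trivial_from \<eta> t (- A) \<longleftrightarrow> trivial_from \<eta> t A"
  by (simp add: trivial_from_def disj_commute)

lemma trivial_from_cong_AE:
  assumes "AE x in \<eta>. x \<in> A \<longleftrightarrow> x \<in> A'"
  shows "trivial_from \<eta> t A \<longleftrightarrow> trivial_from \<eta> t A'"
proof -
  have "(AE x in \<eta>. t \<le> x \<longrightarrow> x \<in> A) \<longleftrightarrow> (AE x in \<eta>. t \<le> x \<longrightarrow> x \<in> A')"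
    using assms by (intro eventually_subst) (auto elim!: eventually_mono)
  moreover have "(AE x in \<eta>. t \<le> x \<longrightarrow> x \<notin> A) \<longleftrightarrow> (AE x in \<eta>. t \<le> x \<longrightarrow> x \<notin> A')"
    using assms by (intro eventually_subst) (auto elim!: eventually_mono)
  ultimately show ?thesis
    by (simp add: trivial_from_def)
qed

text \<open>Triviality on \<open>[t, \<infinity>)\<close> is stable under the \<open>\<sigma>\<close>-field operations and holds for all
  generators. For the converse, a Borel set that almost avoids \<open>[t, \<infinity>)\<close> is the union of a part
  below \<open>t\<close> and a negligible part; the other case follows by taking complements.\<close>

lemma mem_augment_borel_upto_iff:
  assumes sets: "sets \<eta> = sets borel" and A: "A \<in> sets borel"
  shows "A \<in> augment \<eta> (borel_upto t) \<longleftrightarrow> trivial_from \<eta> t A"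
proof
  assume "A \<in> augment \<eta> (borel_upto t)"
  then show "trivial_from \<eta> t A"
    unfolding augment_def
  proof induction
    case (Basic A)
    then show ?case
    proof
      assume "A \<in> borel_upto t"
      then show ?thesis
        unfolding borel_upto_def trivial_from_def by force
    next
      assume "A \<in> negligible_sets \<eta>"
      then obtain N where "N \<in> null_sets \<eta>" "A \<subseteq> N"
        unfolding negligible_sets_def by blast
      then have "AE x in \<eta>. t \<le> x \<longrightarrow> x \<notin> A"
        using AE_not_in[of N \<eta>] by (auto elim: eventually_mono)
      then show ?thesis
        by (simp add: trivial_from_def)
    qed
  next
    case Empty
    then show ?case
      by (simp add: trivial_from_def)
  next
    case (Compl A)
    then show ?case
      by (simp add: trivial_from_Compl flip: Compl_eq_Diff_UNIV)
  next
    case (Union A)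
    show ?case
    proof (cases "\<exists>i. AE x in \<eta>. t \<le> x \<longrightarrow> x \<in> A i")
      case True
      then obtain i where "AE x in \<eta>. t \<le> x \<longrightarrow> x \<in> A i" ..
      then have "AE x in \<eta>. t \<le> x \<longrightarrow> x \<in> (\<Union>i. A i)"
        by eventually_elim auto
      then show ?thesis
        by (simp add: trivial_from_def)
    next
      case False
      with Union have "AE x in \<eta>. \<forall>i. t \<le> x \<longrightarrow> x \<notin> A i"
        unfolding trivial_from_def AE_all_countable by blast
      then have "AE x in \<eta>. t \<le> x \<longrightarrow> x \<notin> (\<Union>i. A i)"
        by eventually_elim auto
      then show ?thesis
        by (simp add: trivial_from_def)
    qed
  qed
next
  have avoids: "A \<in> augment \<eta> (borel_upto t)"
    if A: "A \<in> sets borel" and AE: "AE x in \<eta>. t \<le> x \<longrightarrow> x \<notin> A" for A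
  proof -
    have "A \<inter> {t..} \<in> null_sets \<eta>"
      using A AE by (subst AE_iff_null_sets) (auto simp: sets elim: eventually_mono)
    then have "A \<inter> {t..} \<in> augment \<eta> (borel_upto t)"
      unfolding augment_def negligible_sets_def by (intro sigma_sets.Basic) blast
    moreover have "A \<inter> {..<t} \<in> augment \<eta> (borel_upto t)"
      using A unfolding augment_def borel_upto_def by (intro sigma_sets.Basic) auto
    ultimately have "(A \<inter> {..<t}) \<union> (A \<inter> {t..}) \<in> augment \<eta> (borel_upto t)"
      unfolding augment_def by (intro sigma_sets_Un)
    also have "(A \<inter> {..<t}) \<union> (A \<inter> {t..}) = A"
      by auto
    finally show ?thesis .
  qed
  assume "trivial_from \<eta> t A"
  then consider "AE x in \<eta>. t \<le> x \<longrightarrow> x \<in> A" | "AE x in \<eta>. t \<le> x \<longrightarrow> x \<notin> A"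
    unfolding trivial_from_def by blast
  then show "A \<in> augment \<eta> (borel_upto t)"
  proof cases
    case 1
    then have "UNIV - A \<in> augment \<eta> (borel_upto t)"
      using A by (intro avoids) auto
    then have "UNIV - (UNIV - A) \<in> augment \<eta> (borel_upto t)"
      unfolding augment_def by (rule sigma_sets.Compl)
    then show ?thesis
      by (simp add: double_diff)
  next
    case 2
    with A show ?thesis
      by (rule avoids)
  qed
qed

section \<open>The deterministic plan and its filtration\<close>

lemma sets_eq_borel_if_prob_measures:
  assumes "\<eta> \<in> prob_measures"
  shows "sets \<eta> = sets borel"
  using assms by (simp add: space_prob_algebra)

lemma deterministic_plan_in_transport_plans:
  fixes \<eta> :: "real measure" and T :: "real \<Rightarrow> real"
  assumes \<eta>: "\<eta> \<in> prob_measures" and T [measurable]: "T \<in> borel_measurable borel"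
  shows "deterministic_plan \<eta> T \<in> transport_plans \<eta> (distr \<eta> borel T)"
proof -
  have sets [measurable_cong]: "sets \<eta> = sets borel"
    using \<eta> by (rule sets_eq_borel_if_prob_measures)
  interpret prob_space \<eta>
    using \<eta> by (simp add: space_prob_algebra)
  have [measurable]: "fst \<in> borel_measurable (borel :: (real \<times> real) measure)"
      "snd \<in> borel_measurable (borel :: (real \<times> real) measure)"
    by (intro borel_measurable_continuous_onI continuous_intros)+
  have "prob_space (deterministic_plan \<eta> T)"
    unfolding deterministic_plan_def by (rule prob_space_distr) measurable
  moreover have "distr (deterministic_plan \<eta> T) borel fst = \<eta>"
    unfolding deterministic_plan_def
    by (subst distr_distr) (auto simp: comp_def sets intro!: distr_id2)
  moreover have "distr (deterministic_plan \<eta> T) borel snd = distr \<eta> borel T"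
    unfolding deterministic_plan_def by (subst distr_distr) (auto simp: comp_def)
  ultimately show ?thesis
    by (simp add: transport_plans_def space_prob_algebra deterministic_plan_def)
qed

lemma emeasure_deterministic_plan_Times:
  fixes \<eta> :: "real measure" and T :: "real \<Rightarrow> real"
  assumes sets [measurable_cong]: "sets \<eta> = sets borel"
    and T [measurable]: "T \<in> borel_measurable borel"
    and [measurable]: "A \<in> sets borel" "B \<in> sets borel"
  shows "emeasure (deterministic_plan \<eta> T) (A \<times> B) = (\<integral>\<^sup>+x\<in>A. indicator B (T x) \<partial>\<eta>)"
proof -
  have [simp]: "space \<eta> = UNIV"
    using sets_eq_imp_space_eq[OF sets] by simp
  have "A \<times> B \<in> sets borel"
    by (simp flip: borel_prod)
  then have "emeasure (deterministic_plan \<eta> T) (A \<times> B) = emeasure \<eta> ((\<lambda>x. (x, T x)) -` (A \<times> B))"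
    unfolding deterministic_plan_def by (subst emeasure_distr) auto
  also have "(\<lambda>x. (x, T x)) -` (A \<times> B) = A \<inter> T -` B"
    by auto
  also have "emeasure \<eta> (A \<inter> T -` B) = (\<integral>\<^sup>+x. indicator (A \<inter> T -` B) x \<partial>\<eta>)"
    using measurable_sets_borel[OF T \<open>B \<in> sets borel\<close>]
    by (intro nn_integral_indicator[symmetric]) (auto simp: sets)
  also have "\<dots> = (\<integral>\<^sup>+x\<in>A. indicator B (T x) \<partial>\<eta>)"
    by (intro nn_integral_cong) (auto simp: indicator_def)
  finally show ?thesis .
qed

lemma is_transport_kernel_transport_kernel_deterministic_plan:
  fixes \<eta> :: "real measure" and T :: "real \<Rightarrow> real"
  assumes sets: "sets \<eta> = sets borel" and T [measurable]: "T \<in> borel_measurable borel"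
  shows "is_transport_kernel \<eta> (deterministic_plan \<eta> T)
    (transport_kernel \<eta> (deterministic_plan \<eta> T))"
  unfolding transport_kernel_def
proof (rule someI[where P = "is_transport_kernel \<eta> (deterministic_plan \<eta> T)"])
  show "is_transport_kernel \<eta> (deterministic_plan \<eta> T) (\<lambda>x. return borel (T x))"
    using emeasure_deterministic_plan_Times[OF sets T]
    by (auto simp: is_transport_kernel_def space_prob_algebra prob_space_return measure_return)
qed

text \<open>For a fixed \<open>B\<close>, the functions \<open>x \<mapsto> Q\<^sup>x(B)\<close> and \<open>x \<mapsto> \<delta>\<^bsub>T x\<^esub>(B)\<close> are densities of the same
  measure \<open>A \<mapsto> \<gamma>(A \<times> B)\<close>, so they agree almost everywhere.\<close>

lemma AE_transport_kernel_deterministic_plan: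
  fixes \<eta> :: "real measure" and T :: "real \<Rightarrow> real"
  assumes \<eta>: "\<eta> \<in> prob_measures" and T [measurable]: "T \<in> borel_measurable borel"
    and Q: "is_transport_kernel \<eta> (deterministic_plan \<eta> T) Q"
    and B [measurable]: "B \<in> sets borel"
  shows "AE x in \<eta>. measure (Q x) B = indicator B (T x)"
proof -
  have sets [measurable_cong]: "sets \<eta> = sets borel"
    using \<eta> by (rule sets_eq_borel_if_prob_measures)
  interpret prob_space \<eta>
    using \<eta> by (simp add: space_prob_algebra)
  have emeasure_Q: "emeasure (Q x) B = ennreal (measure (Q x) B)" for x
  proof -
    interpret Q: prob_space "Q x"
      using Q by (simp add: is_transport_kernel_def space_prob_algebra)
    show ?thesis
      by (rule Q.emeasure_eq_measure)
  qed
  have [measurable]: "(\<lambda>x. emeasure (Q x) B) \<in> borel_measurable borel"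
    unfolding emeasure_Q using Q B by (auto simp: is_transport_kernel_def)
  have "AE x in \<eta>. emeasure (Q x) B = indicator B (T x)"
  proof (rule density_unique_finite_measure)
    fix A assume "A \<in> sets \<eta>"
    then have "A \<in> sets borel"
      by (simp add: sets)
    then show "(\<integral>\<^sup>+x\<in>A. emeasure (Q x) B \<partial>\<eta>) = (\<integral>\<^sup>+x\<in>A. indicator B (T x) \<partial>\<eta>)"
      using Q B emeasure_deterministic_plan_Times[OF sets T _ B]
      by (simp add: is_transport_kernel_def)
  qed simp_all
  then show ?thesis
    by eventually_elim (auto simp: measure_def indicator_def split: if_splits)
qed

text \<open>As \<open>Q\<^sup>x(B)\<close> is almost everywhere the indicator of \<open>T -` B\<close>, the preimage of \<open>{1}\<close> recovers
  \<open>T -` B\<close>, while any other preimage is, up to a negligible set, \<open>T -` B\<close>, its complement, or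
  trivial.\<close>

lemma deterministic_plan_causal_iff:
  fixes \<eta> :: "real measure" and T :: "real \<Rightarrow> real"
  assumes \<eta>: "\<eta> \<in> prob_measures" and T [measurable]: "T \<in> borel_measurable borel"
  shows "deterministic_plan \<eta> T \<in> causal_plans \<eta> \<nu> \<longleftrightarrow>
    \<nu> = distr \<eta> borel T \<and>
    (\<forall>t. \<forall>B\<in>borel_upto t. emeasure \<nu> (frontier B) = 0 \<longrightarrow> trivial_from \<eta> t (T -` B))"
proof (cases "\<nu> = distr \<eta> borel T")
  case True
  have sets: "sets \<eta> = sets borel"
    using \<eta> by (rule sets_eq_borel_if_prob_measures)
  define Q where "Q = transport_kernel \<eta> (deterministic_plan \<eta> T)"
  have Q: "is_transport_kernel \<eta> (deterministic_plan \<eta> T) Q"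
    unfolding Q_def using sets T by (rule is_transport_kernel_transport_kernel_deterministic_plan)
  have preimage: "(\<lambda>x. measure (Q x) B) -` S \<in> augment \<eta> (borel_upto t) \<longleftrightarrow>
      trivial_from \<eta> t {x. indicator B (T x) \<in> S}"
    if "B \<in> sets borel" "S \<in> sets borel" for B S t
  proof -
    have "(\<lambda>x. measure (Q x) B) \<in> borel_measurable borel"
      using Q that by (auto simp: is_transport_kernel_def)
    then have "(\<lambda>x. measure (Q x) B) -` S \<in> sets borel"
      using \<open>S \<in> sets borel\<close> by (rule measurable_sets_borel)
    then have "(\<lambda>x. measure (Q x) B) -` S \<in> augment \<eta> (borel_upto t) \<longleftrightarrow>
        trivial_from \<eta> t ((\<lambda>x. measure (Q x) B) -` S)"
      using sets by (intro mem_augment_borel_upto_iff)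
    also have "\<dots> \<longleftrightarrow> trivial_from \<eta> t {x. indicator B (T x) \<in> S}"
      using AE_transport_kernel_deterministic_plan[OF \<eta> T Q \<open>B \<in> sets borel\<close>]
      by (intro trivial_from_cong_AE) (auto elim!: eventually_mono)
    finally show ?thesis .
  qed
  have causal_at: "plan_filtration \<eta> \<nu> (deterministic_plan \<eta> T) t \<subseteq> augment \<eta> (borel_upto t) \<longleftrightarrow>
      (\<forall>B\<in>borel_upto t. emeasure \<nu> (frontier B) = 0 \<longrightarrow> trivial_from \<eta> t (T -` B))"
    (is "?L \<longleftrightarrow> ?R") for t
  proof
    assume L: ?L
    show ?R
    proof (intro ballI impI)
      fix B assume B: "B \<in> borel_upto t" "emeasure \<nu> (frontier B) = 0"
      then have "(\<lambda>x. measure (Q x) B) -` {1} \<in> plan_filtration \<eta> \<nu> (deterministic_plan \<eta> T) t"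
        unfolding plan_filtration_def augment_def Q_def
        by (intro sigma_sets.Basic UnI1 CollectI exI[of _ B] exI[of _ "{1}"]) auto
      with L have "(\<lambda>x. measure (Q x) B) -` {1} \<in> augment \<eta> (borel_upto t)"
        by blast
      with B have "trivial_from \<eta> t {x. indicator B (T x) \<in> {1::real}}"
        by (subst (asm) preimage) (auto simp: borel_upto_def)
      also have "{x. indicator B (T x) \<in> {1::real}} = T -` B"
        by (auto simp: indicator_def)
      finally show "trivial_from \<eta> t (T -` B)" .
    qed
  next
    assume R: ?R
    have "(\<lambda>x. measure (Q x) B) -` S \<in> augment \<eta> (borel_upto t)"
      if B: "B \<in> borel_upto t" "emeasure \<nu> (frontier B) = 0" and S: "S \<in> sets borel" for B S
    proof -
      have "trivial_from \<eta> t (T -` B)"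
        using R B by blast
      then have "trivial_from \<eta> t A" if "A \<in> {{}, UNIV, T -` B, - (T -` B)}" for A
        using that trivial_from_Compl[of \<eta> t "T -` B"]
        by (elim insertE emptyE)
          (simp_all add: trivial_from_def[of _ _ "{}"] trivial_from_def[of _ _ UNIV])
      moreover have "{x. indicator B (T x) \<in> S} \<in> {{}, UNIV, T -` B, - (T -` B)}"
        by (cases "0 \<in> S"; cases "1 \<in> S") (auto simp: indicator_def split: if_splits)
      ultimately have "trivial_from \<eta> t {x. indicator B (T x) \<in> S}"
        by blast
      with B S show ?thesis
        by (subst preimage) (auto simp: borel_upto_def)
    qed
    then have generators: "{(\<lambda>x. measure (Q x) B) -` S | B S.
        B \<in> borel_upto t \<and> emeasure \<nu> (frontier B) = 0 \<and> S \<in> sets borel}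
        \<subseteq> augment \<eta> (borel_upto t)"
      by blast
    have "negligible_sets \<eta> \<subseteq> augment \<eta> (borel_upto t)"
      unfolding augment_def by (rule subsetI, rule sigma_sets.Basic, rule UnI2)
    with generators show ?L
      unfolding plan_filtration_def augment_def Q_def[symmetric]
      by (intro sigma_sets_mono Un_least)
  qed
  show ?thesis
    using deterministic_plan_in_transport_plans[OF \<eta> T] True causal_at
    by (auto simp: causal_plans_def)
next
  case False
  then show ?thesis
    using deterministic_plan_in_transport_plans[OF \<eta> T]
    by (auto simp: causal_plans_def transport_plans_def)
qed

section \<open>Almost sure inequalities between reals\<close>

lemma AE_imp_ge_if_gt_below:
  fixes f :: "'a \<Rightarrow> real"
  assumes "\<And>p. p < c \<Longrightarrow> AE x in M. P x \<longrightarrow> p < f x"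
  shows "AE x in M. P x \<longrightarrow> c \<le> f x"
proof -
  have "AE x in M. \<forall>q. of_rat q < c \<longrightarrow> P x \<longrightarrow> of_rat q < f x"
    unfolding AE_all_countable using assms by (auto intro: AE_I2)
  then show ?thesis
    by eventually_elim (metis not_less of_rat_dense order.asym)
qed

lemma AE_imp_le_if_le_above:
  fixes f :: "'a \<Rightarrow> real"
  assumes "\<And>p. c < p \<Longrightarrow> AE x in M. P x \<longrightarrow> f x \<le> p"
  shows "AE x in M. P x \<longrightarrow> f x \<le> c"
proof -
  have "AE x in M. \<forall>q. c < of_rat q \<longrightarrow> P x \<longrightarrow> f x \<le> of_rat q"
    unfolding AE_all_countable using assms by (auto intro: AE_I2)
  then show ?thesis
    by eventually_elim (metis not_less of_rat_dense)
qed

text \<open>A point violating \<open>x \<le> f x\<close> is separated from its image by a rational time.\<close>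

lemma AE_le_if_no_bad_time:
  fixes f :: "real \<Rightarrow> real"
  assumes "\<And>q. q \<le> c \<Longrightarrow> AE x in M. q \<le> x \<longrightarrow> q \<le> f x"
  shows "AE x in M. x \<le> c \<longrightarrow> x \<le> f x"
proof -
  have "AE x in M. \<forall>q. of_rat q \<le> c \<longrightarrow> of_rat q \<le> x \<longrightarrow> of_rat q \<le> f x"
    unfolding AE_all_countable using assms by (auto intro: AE_I2)
  then show ?thesis
    by eventually_elim (metis less_imp_le not_less of_rat_dense order.trans)
qed

section \<open>Deterministic maps satisfying the zero-one law\<close>

lemma ex_non_atom_between:
  fixes p q :: real
  assumes "finite_measure M" "p < q"
  shows "\<exists>a. p < a \<and> a < q \<and> emeasure M {a} = 0"
proof (rule ccontr)
  interpret finite_measure M by fact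
  assume "\<not> ?thesis"
  then have "{p<..<q} \<subseteq> {a. measure M {a} \<noteq> 0}"
    by (auto simp: emeasure_eq_measure)
  then have "countable {p<..<q}"
    using countable_support countable_subset by blast
  with \<open>p < q\<close> show False
    using uncountable_open_interval by blast
qed

text \<open>The constant is the infimum of the almost sure upper bounds \<open>a\<close> of \<open>T\<close> on \<open>[t, \<infinity>)\<close>. Below
  \<open>t\<close>, a number that is not an almost sure upper bound is nearly an almost sure lower bound, by the
  zero-one law at a non-atom just below it.\<close>

lemma constant_after_bad_time:
  fixes \<eta> :: "real measure" and T :: "real \<Rightarrow> real"
  assumes \<eta>: "\<eta> \<in> prob_measures" and T [measurable]: "T \<in> borel_measurable borel"
    and zero_one: "\<And>B. B \<in> borel_upto t \<Longrightarrow> emeasure (distr \<eta> borel T) (frontier B) = 0 \<Longrightarrow>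
      trivial_from \<eta> t (T -` B)"
    and bad: "\<not> (AE x in \<eta>. t \<le> x \<longrightarrow> t \<le> T x)"
  shows "\<exists>c<t. AE x in \<eta>. t \<le> x \<longrightarrow> T x = c"
proof -
  have sets [measurable_cong]: "sets \<eta> = sets borel"
    using \<eta> by (rule sets_eq_borel_if_prob_measures)
  interpret prob_space \<eta>
    using \<eta> by (simp add: space_prob_algebra)
  interpret \<nu>: prob_space "distr \<eta> borel T"
    by (rule prob_space_distr) measurable
  define U where "U = {a. AE x in \<eta>. t \<le> x \<longrightarrow> T x \<le> a}"
  have U_mono: "b \<in> U" if "a \<in> U" "a \<le> b" for a b
    using that unfolding U_def by (auto elim!: eventually_mono)
  have dichotomy: "q \<in> U \<or> (AE x in \<eta>. t \<le> x \<longrightarrow> p < T x)" if "p < q" "q \<le> t" for p q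
  proof -
    obtain a where a: "p < a" "a < q" "emeasure (distr \<eta> borel T) {a} = 0"
      using ex_non_atom_between[OF \<nu>.finite_measure_axioms \<open>p < q\<close>] by auto
    have "frontier {..a} = {a}"
      by (auto simp: frontier_def)
    with a \<open>q \<le> t\<close> have "trivial_from \<eta> t (T -` {..a})"
      by (intro zero_one) (auto simp: borel_upto_def)
    then show ?thesis
      unfolding trivial_from_def
    proof
      assume "AE x in \<eta>. t \<le> x \<longrightarrow> x \<in> T -` {..a}"
      then have "a \<in> U"
        by (simp add: U_def)
      then show ?thesis
        using U_mono[of a q] a by simp
    next
      assume "AE x in \<eta>. t \<le> x \<longrightarrow> x \<notin> T -` {..a}"
      then have "AE x in \<eta>. t \<le> x \<longrightarrow> p < T x"
        by eventually_elim (use a in auto)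
      then show ?thesis ..
    qed
  qed
  obtain a where a: "a \<in> U" "a < t"
  proof (rule ccontr)
    assume no_bound: "\<not> thesis"
    have "AE x in \<eta>. t \<le> x \<longrightarrow> t \<le> T x"
    proof (rule AE_imp_ge_if_gt_below)
      fix p assume "p < t"
      then obtain q where "p < q" "q < t"
        using dense by blast
      then show "AE x in \<eta>. t \<le> x \<longrightarrow> p < T x"
        using dichotomy[of p q] no_bound that by auto
    qed
    with bad show False ..
  qed
  \<comment> \<open>If \<open>U\<close> were unbounded below, no real number could be \<open>T x\<close> for typical \<open>x \<ge> t\<close>, so
    \<open>[t, \<infinity>)\<close> would be negligible and \<open>t\<close> could not be bad.\<close>
  have bdd: "bdd_below U"
  proof (rule ccontr)
    assume unbdd: "\<not> bdd_below U"
    have "a \<in> U" for a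
      using unbdd U_mono by (meson bdd_below.I linear)
    then have "AE x in \<eta>. \<forall>n. t \<le> x \<longrightarrow> T x \<le> - real n"
      unfolding AE_all_countable U_def by blast
    then have "AE x in \<eta>. t \<le> x \<longrightarrow> t \<le> T x"
    proof eventually_elim
      case (elim x)
      obtain n where "- T x < real n"
        using reals_Archimedean2 by blast
      moreover have "t \<le> x \<longrightarrow> T x \<le> - real n"
        using elim by blast
      ultimately show ?case
        by linarith
    qed
    with bad show False ..
  qed
  define c where "c = Inf U"
  have "c < t"
    using cInf_lower[OF a(1) bdd] a(2) by (simp add: c_def)
  have "AE x in \<eta>. t \<le> x \<longrightarrow> T x \<le> c"
  proof (rule AE_imp_le_if_le_above)
    fix p assume "c < p"
    then obtain b where "b \<in> U" "b < p"
      using a bdd cInf_less_iff[of U p] by (auto simp: c_def)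
    then have "p \<in> U"
      using U_mono by simp
    then show "AE x in \<eta>. t \<le> x \<longrightarrow> T x \<le> p"
      by (simp add: U_def)
  qed
  moreover have "AE x in \<eta>. t \<le> x \<longrightarrow> c \<le> T x"
  proof (rule AE_imp_ge_if_gt_below)
    fix p assume "p < c"
    then obtain q where q: "p < q" "q < c"
      using dense by blast
    then have "q \<notin> U"
      using cInf_lower[OF _ bdd, of q] by (auto simp: c_def)
    with q \<open>c < t\<close> show "AE x in \<eta>. t \<le> x \<longrightarrow> p < T x"
      using dichotomy[of p q] by auto
  qed
  ultimately have "AE x in \<eta>. t \<le> x \<longrightarrow> T x = c"
    by eventually_elim auto
  with \<open>c < t\<close> show ?thesis
    by blast
qed

text \<open>The constants attached to two bad times coincide, since both are the value of \<open>T\<close> on the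
  half-line from the later time, which is not negligible. The common constant is the threshold
  \<open>t\<^sub>0\<close>: it lies below every bad time, and badness propagates down to it.\<close>

lemma causal_conditions_if_constant_after_bad_times:
  fixes \<eta> :: "real measure" and T :: "real \<Rightarrow> real"
  assumes const: "\<And>t. \<not> (AE x in \<eta>. t \<le> x \<longrightarrow> t \<le> T x) \<Longrightarrow>
      \<exists>c<t. AE x in \<eta>. t \<le> x \<longrightarrow> T x = c"
    and not_above: "\<not> (AE x in \<eta>. x \<le> T x)"
  shows "\<exists>t0. (AE x in \<eta>. x \<le> t0 \<longrightarrow> x \<le> T x) \<and> (AE x in \<eta>. t0 < x \<longrightarrow> T x = t0)"
proof -
  define bad where "bad t \<longleftrightarrow> \<not> (AE x in \<eta>. t \<le> x \<longrightarrow> t \<le> T x)" for t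
  have charged: "\<not> (AE x in \<eta>. \<not> t \<le> x)" if "bad t" for t
  proof
    assume "AE x in \<eta>. \<not> t \<le> x"
    then have "AE x in \<eta>. t \<le> x \<longrightarrow> t \<le> T x"
      by eventually_elim simp
    with that show False
      by (simp add: bad_def)
  qed
  obtain t where t: "bad t"
  proof (rule ccontr)
    assume "\<not> thesis"
    then have "AE x in \<eta>. x \<le> c \<longrightarrow> x \<le> T x" for c
      using that by (intro AE_le_if_no_bad_time) (auto simp: bad_def)
    then have "AE x in \<eta>. \<forall>n. x \<le> real n \<longrightarrow> x \<le> T x"
      unfolding AE_all_countable by blast
    then have "AE x in \<eta>. x \<le> T x"
      by eventually_elim (use real_arch_simple in blast)
    with not_above show False ..
  qed
  then obtain c where c: "c < t" "AE x in \<eta>. t \<le> x \<longrightarrow> T x = c"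
    using const unfolding bad_def by blast
  have bad_const: "c < s \<and> (AE x in \<eta>. s \<le> x \<longrightarrow> T x = c)" if "bad s" for s
  proof -
    obtain c' where c': "c' < s" "AE x in \<eta>. s \<le> x \<longrightarrow> T x = c'"
      using const \<open>bad s\<close> unfolding bad_def by blast
    have "c' = c"
    proof (rule ccontr)
      assume "c' \<noteq> c"
      have "AE x in \<eta>. \<not> max s t \<le> x"
        using c(2) c'(2) by eventually_elim (use \<open>c' \<noteq> c\<close> in auto)
      moreover have "bad (max s t)"
        using t \<open>bad s\<close> by (simp add: max_def)
      ultimately show False
        using charged by blast
    qed
    with c' show ?thesis
      by simp
  qed
  have const_after: "AE x in \<eta>. s \<le> x \<longrightarrow> T x = c" if "c < s" for s
  proof (cases "t \<le> s")
    case True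
    with c(2) show ?thesis
      by (auto elim!: eventually_mono)
  next
    case False
    \<comment> \<open>Almost every point of \<open>[t, \<infinity>) \<subseteq> [s, \<infinity>)\<close> is sent to \<open>c < s\<close>.\<close>
    have "bad s"
      unfolding bad_def
    proof
      assume "AE x in \<eta>. s \<le> x \<longrightarrow> s \<le> T x"
      with c(2) have "AE x in \<eta>. \<not> t \<le> x"
        by eventually_elim (use False \<open>c < s\<close> in auto)
      with charged[OF t] show False ..
    qed
    then show ?thesis
      using bad_const by blast
  qed
  have "AE x in \<eta>. \<forall>q. c < of_rat q \<longrightarrow> of_rat q \<le> x \<longrightarrow> T x = c"
    unfolding AE_all_countable using const_after by (auto intro: AE_I2)
  then have "AE x in \<eta>. c < x \<longrightarrow> T x = c"
    by eventually_elim (metis less_imp_le of_rat_dense)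
  moreover have "AE x in \<eta>. x \<le> c \<longrightarrow> x \<le> T x"
  proof (rule AE_le_if_no_bad_time)
    fix q assume "q \<le> c"
    then have "\<not> bad q"
      using bad_const[of q] by auto
    then show "AE x in \<eta>. q \<le> x \<longrightarrow> q \<le> T x"
      by (simp add: bad_def)
  qed
  ultimately show ?thesis
    by blast
qed

lemma trivial_from_if_ge:
  assumes "AE x in \<eta>. t \<le> x \<longrightarrow> t \<le> T x" "B \<in> borel_upto t"
  shows "trivial_from \<eta> t (T -` B)"
proof (cases "B \<subseteq> {..<t}")
  case True
  with assms(1) have "AE x in \<eta>. t \<le> x \<longrightarrow> x \<notin> T -` B"
    by (auto elim!: eventually_mono)
  then show ?thesis
    by (simp add: trivial_from_def)
next
  case False
  with assms(2) have "{t..} \<subseteq> B"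
    by (simp add: borel_upto_def)
  with assms(1) have "AE x in \<eta>. t \<le> x \<longrightarrow> x \<in> T -` B"
    by (auto elim!: eventually_mono)
  then show ?thesis
    by (simp add: trivial_from_def)
qed

lemma trivial_from_if_constant:
  assumes "AE x in \<eta>. t \<le> x \<longrightarrow> T x = c"
  shows "trivial_from \<eta> t (T -` B)"
proof (cases "c \<in> B")
  case True
  with assms have "AE x in \<eta>. t \<le> x \<longrightarrow> x \<in> T -` B"
    by (auto elim!: eventually_mono)
  then show ?thesis
    by (simp add: trivial_from_def)
next
  case False
  with assms have "AE x in \<eta>. t \<le> x \<longrightarrow> x \<notin> T -` B"
    by (auto elim!: eventually_mono)
  then show ?thesis
    by (simp add: trivial_from_def)
qed

section \<open>Characterisation of causal deterministic plans\<close>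

theorem theorem3p1:
  fixes \<eta> \<nu> :: "real measure" and T :: "real \<Rightarrow> real"
  assumes "\<eta> \<in> prob_measures"
    and "T \<in> borel_measurable borel"
    and "\<nu> = distr \<eta> borel T"
  shows "deterministic_plan \<eta> T \<in> causal_plans \<eta> \<nu> \<longleftrightarrow>
    (AE x in \<eta>. T x \<ge> x) \<or>
    (\<exists>t0. (AE x in \<eta>. x \<le> t0 \<longrightarrow> T x \<ge> x) \<and> (AE x in \<eta>. x > t0 \<longrightarrow> T x = t0))"
proof
  assume "deterministic_plan \<eta> T \<in> causal_plans \<eta> \<nu>"
  then have "\<exists>c<t. AE x in \<eta>. t \<le> x \<longrightarrow> T x = c"
    if "\<not> (AE x in \<eta>. t \<le> x \<longrightarrow> t \<le> T x)" for t
    using that assms unfolding deterministic_plan_causal_iff[OF assms(1,2)]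
    by (intro constant_after_bad_time) auto
  then show "(AE x in \<eta>. T x \<ge> x) \<or>
      (\<exists>t0. (AE x in \<eta>. x \<le> t0 \<longrightarrow> T x \<ge> x) \<and> (AE x in \<eta>. x > t0 \<longrightarrow> T x = t0))"
    using causal_conditions_if_constant_after_bad_times by blast
next
  assume cond: "(AE x in \<eta>. T x \<ge> x) \<or>
    (\<exists>t0. (AE x in \<eta>. x \<le> t0 \<longrightarrow> T x \<ge> x) \<and> (AE x in \<eta>. x > t0 \<longrightarrow> T x = t0))"
  have "trivial_from \<eta> t (T -` B)" if B: "B \<in> borel_upto t" for t B
    using cond
  proof (elim disjE exE conjE)
    assume "AE x in \<eta>. T x \<ge> x"
    then have "AE x in \<eta>. t \<le> x \<longrightarrow> t \<le> T x"
      by eventually_elim auto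
    then show ?thesis
      using B by (rule trivial_from_if_ge)
  next
    fix t0
    assume t0: "AE x in \<eta>. x \<le> t0 \<longrightarrow> T x \<ge> x" "AE x in \<eta>. x > t0 \<longrightarrow> T x = t0"
    show ?thesis
    proof (cases "t \<le> t0")
      case True
      from t0 have "AE x in \<eta>. t \<le> x \<longrightarrow> t \<le> T x"
        by eventually_elim (use True in force)
      then show ?thesis
        using B by (rule trivial_from_if_ge)
    next
      case False
      from t0(2) have "AE x in \<eta>. t \<le> x \<longrightarrow> T x = t0"
        by eventually_elim (use False in auto)
      then show ?thesis
        by (rule trivial_from_if_constant)
    qed
  qed
  with assms show "deterministic_plan \<eta> T \<in> causal_plans \<eta> \<nu>"
    by (simp add: deterministic_plan_causal_iff)
qed

end
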